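(* Let $F_2$ be the free group on two generators. For every integer $n \in \mathbb{Z}$ there exists a finite subset $A_n \subseteq F_2$ such that $|A_nA_n^{-1}| - |A_n^{-1}A_n| = 2n$.
   Context: For a finite subset $A$ of a group $G$, the right quotient set is $AA^{-1} = \{a b^{-1} : a, b \in A\}$ and the left quotient set is $A^{-1}A = \{a^{-1} b : a, b \in A\}$. *)

theory Defs
  imports "HOL-Algebra.Coset"
begin

text \<open>
  The free group on a set \<open>S\<close>, realised on reduced words. A letter \<open>(s, True)\<close> stands for the
  generator \<open>s\<close>, a letter \<open>(s, False)\<close> for its formal inverse.
\<close>

type_synonym 'a word = "('a \<times> bool) list"

definition inv_letter :: "'a \<times> bool \<Rightarrow> 'a \<times> bool" where
  "inv_letter x = (fst x, \<not> snd x)"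

definition reduced :: "'a word \<Rightarrow> bool" where
  "reduced w \<longleftrightarrow> successively (\<lambda>x y. y \<noteq> inv_letter x) w"

fun cons_letter :: "'a \<times> bool \<Rightarrow> 'a word \<Rightarrow> 'a word" where
  "cons_letter x [] = [x]"
| "cons_letter x (y # w) = (if y = inv_letter x then w else x # y # w)"

text \<open>For reduced \<open>u\<close> and \<open>v\<close>, \<open>word_mult u v\<close> is the reduced form of \<open>u @ v\<close>.\<close>

definition word_mult :: "'a word \<Rightarrow> 'a word \<Rightarrow> 'a word" where
  "word_mult u v = foldr cons_letter u v"

definition free_group :: "'a set \<Rightarrow> 'a word monoid" where
  "free_group S = \<lparr>carrier = {w. reduced w \<and> fst ` set w \<subseteq> S}, mult = word_mult, one = []\<rparr>"

definition F2 :: "nat word monoid" where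
  "F2 = free_group {0, 1}"

definition right_quotient_set :: "('a, 'b) monoid_scheme \<Rightarrow> 'a set \<Rightarrow> 'a set" where
  "right_quotient_set G A = {a \<otimes>\<^bsub>G\<^esub> inv\<^bsub>G\<^esub> b | a b. a \<in> A \<and> b \<in> A}"

definition left_quotient_set :: "('a, 'b) monoid_scheme \<Rightarrow> 'a set \<Rightarrow> 'a set" where
  "left_quotient_set G A = {inv\<^bsub>G\<^esub> a \<otimes>\<^bsub>G\<^esub> b | a b. a \<in> A \<and> b \<in> A}"


text \<open>The construction is a group and has the universal property of the free group on \<open>S\<close>.\<close>

lemma inv_letter_inv_letter [simp]: "inv_letter (inv_letter x) = x"
  and fst_inv_letter [simp]: "fst (inv_letter x) = fst x"
  and inv_letter_neq: "inv_letter x \<noteq> x"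
  by (auto simp: inv_letter_def prod_eq_iff)

lemma word_mult_Nil [simp]: "word_mult [] v = v"
  and word_mult_Cons [simp]: "word_mult (x # u) v = cons_letter x (word_mult u v)"
  and word_mult_append: "word_mult (u @ u') v = word_mult u (word_mult u' v)"
  by (simp_all add: word_mult_def)

lemma reduced_Nil [simp]: "reduced []"
  and reduced_single [simp]: "reduced [x]"
  and reduced_Cons_Cons [simp]:
    "reduced (x # y # w) \<longleftrightarrow> y \<noteq> inv_letter x \<and> reduced (y # w)"
  by (simp_all add: reduced_def)

lemma reduced_ConsD: "reduced (x # w) \<Longrightarrow> reduced w"
  by (cases w) auto

lemma cons_letter_reduced: "reduced (x # w) \<Longrightarrow> cons_letter x w = x # w"
  by (cases w) auto

lemma reduced_cons_letter: "reduced w \<Longrightarrow> reduced (cons_letter x w)"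
  by (cases w) (auto dest: reduced_ConsD)

lemma cons_letter_cancel:
  assumes "reduced w"
  shows "cons_letter x (cons_letter (inv_letter x) w) = w"
proof (cases w)
  case Nil
  then show ?thesis by simp
next
  case (Cons y v)
  then show ?thesis using assms by (cases "y = x") (auto simp: cons_letter_reduced)
qed

lemma reduced_word_mult: "reduced v \<Longrightarrow> reduced (word_mult u v)"
  by (induction u) (auto simp: reduced_cons_letter)

lemma word_mult_cons_letter:
  assumes "reduced w"
  shows "word_mult (cons_letter x v) w = cons_letter x (word_mult v w)"
  using assms cons_letter_cancel[OF reduced_word_mult[OF assms]]
  by (cases v) auto

lemma word_mult_assoc:
  assumes "reduced w"
  shows "word_mult (word_mult u v) w = word_mult u (word_mult v w)"
  by (induction u) (simp_all add: word_mult_cons_letter[OF assms])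

lemma word_mult_Nil_right: "reduced u \<Longrightarrow> word_mult u [] = u"
proof (induction u)
  case (Cons x u)
  then show ?case using reduced_ConsD[OF Cons.prems] by (simp add: cons_letter_reduced)
qed simp

lemma set_cons_letter: "set (cons_letter x w) \<subseteq> insert x (set w)"
  by (cases w) auto

lemma set_word_mult: "set (word_mult u v) \<subseteq> set u \<union> set v"
  using set_cons_letter by (induction u) fastforce+

lemma letters_word_mult:
  "\<lbrakk>fst ` set u \<subseteq> S; fst ` set v \<subseteq> S\<rbrakk> \<Longrightarrow> fst ` set (word_mult u v) \<subseteq> S"
  using image_mono[OF set_word_mult, of fst u v] unfolding image_Un by (meson Un_least order_trans)

lemma word_mult_inverse: "word_mult (rev (map inv_letter u)) u = []"
  by (induction u) (auto simp: word_mult_append)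

lemma reduced_inverse: "reduced u \<Longrightarrow> reduced (rev (map inv_letter u))"
  unfolding reduced_def successively_rev successively_map
  by (erule successively_mono) (metis inv_letter_inv_letter)

lemma free_group_simps:
  "carrier (free_group S) = {w. reduced w \<and> fst ` set w \<subseteq> S}"
  "u \<otimes>\<^bsub>free_group S\<^esub> v = word_mult u v"
  "\<one>\<^bsub>free_group S\<^esub> = []"
  by (simp_all add: free_group_def)

theorem group_free_group: "group (free_group S)"
proof (rule groupI)
  fix u v assume "u \<in> carrier (free_group S)" "v \<in> carrier (free_group S)"
  then show "u \<otimes>\<^bsub>free_group S\<^esub> v \<in> carrier (free_group S)"
    by (simp add: free_group_simps reduced_word_mult letters_word_mult)
next
  fix u assume "u \<in> carrier (free_group S)"
  then have "rev (map inv_letter u) \<in> carrier (free_group S)"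
    by (auto simp: free_group_simps reduced_inverse)
  then show "\<exists>v\<in>carrier (free_group S). v \<otimes>\<^bsub>free_group S\<^esub> u = \<one>\<^bsub>free_group S\<^esub>"
    by (rule rev_bexI) (simp add: free_group_simps word_mult_inverse)
qed (auto simp: free_group_simps word_mult_assoc)

lemma inv_free_group:
  assumes "u \<in> carrier (free_group S)"
  shows "inv\<^bsub>free_group S\<^esub> u = rev (map inv_letter u)"
proof (rule group.inv_equality[OF group_free_group])
  show "rev (map inv_letter u) \<in> carrier (free_group S)"
    using assms by (auto simp: free_group_simps reduced_inverse)
qed (use assms in \<open>auto simp: free_group_simps word_mult_inverse\<close>)

definition letter_val :: "('b, 'c) monoid_scheme \<Rightarrow> ('a \<Rightarrow> 'b) \<Rightarrow> 'a \<times> bool \<Rightarrow> 'b" where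
  "letter_val H f x = (if snd x then f (fst x) else inv\<^bsub>H\<^esub> f (fst x))"

definition word_val :: "('b, 'c) monoid_scheme \<Rightarrow> ('a \<Rightarrow> 'b) \<Rightarrow> 'a word \<Rightarrow> 'b" where
  "word_val H f w = foldr (\<lambda>x y. letter_val H f x \<otimes>\<^bsub>H\<^esub> y) w \<one>\<^bsub>H\<^esub>"

lemma word_val_simps [simp]:
  "word_val H f [] = \<one>\<^bsub>H\<^esub>"
  "word_val H f (x # w) = letter_val H f x \<otimes>\<^bsub>H\<^esub> word_val H f w"
  by (simp_all add: word_val_def)

context
  fixes H (structure) and f :: "'a \<Rightarrow> 'b" and S
  assumes H: "group H" and f: "f \<in> S \<rightarrow> carrier H"
begin

interpretation group H by (rule H)

lemma letter_val_closed: "fst x \<in> S \<Longrightarrow> letter_val H f x \<in> carrier H"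
  using f by (auto simp: letter_val_def)

lemma word_val_closed: "fst ` set w \<subseteq> S \<Longrightarrow> word_val H f w \<in> carrier H"
  by (induction w) (auto simp: letter_val_closed)

lemma letter_val_inv: "fst x \<in> S \<Longrightarrow> letter_val H f (inv_letter x) = inv (letter_val H f x)"
  using f by (simp add: letter_val_def inv_letter_def Pi_iff)

lemma word_val_cons_letter:
  assumes "fst x \<in> S" "fst ` set w \<subseteq> S"
  shows "word_val H f (cons_letter x w) = letter_val H f x \<otimes> word_val H f w"
proof (cases w)
  case (Cons y v)
  then show ?thesis
    using assms letter_val_closed[of x] word_val_closed[of v]
    by (auto simp: letter_val_inv m_assoc[symmetric])
qed auto

lemma word_val_word_mult:
  assumes "fst ` set u \<subseteq> S" "fst ` set v \<subseteq> S"
  shows "word_val H f (word_mult u v) = word_val H f u \<otimes> word_val H f v"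
  using assms(1)
proof (induction u)
  case (Cons x u)
  have "fst ` set (word_mult u v) \<subseteq> S"
    using Cons.prems assms(2) by (simp add: letters_word_mult)
  then show ?case
    using Cons assms(2) by (auto simp: word_val_cons_letter m_assoc letter_val_closed word_val_closed)
qed (simp add: word_val_closed assms(2))

theorem free_group_universal:
  shows "\<exists>h \<in> hom (free_group S) H. \<forall>s\<in>S. h [(s, True)] = f s"
    and "\<lbrakk>h \<in> hom (free_group S) H; h' \<in> hom (free_group S) H;
          \<forall>s\<in>S. h [(s, True)] = f s; \<forall>s\<in>S. h' [(s, True)] = f s;
          w \<in> carrier (free_group S)\<rbrakk> \<Longrightarrow> h w = h' w"
proof -
  have "word_val H f \<in> hom (free_group S) H"
    by (auto simp: hom_def free_group_simps word_val_closed word_val_word_mult)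
  moreover have "\<forall>s\<in>S. word_val H f [(s, True)] = f s"
    using f by (simp add: letter_val_def Pi_iff)
  ultimately show "\<exists>h \<in> hom (free_group S) H. \<forall>s\<in>S. h [(s, True)] = f s"
    by blast
next
  have val: "h w = word_val H f w"
    if h: "h \<in> hom (free_group S) H" and gen: "\<forall>s\<in>S. h [(s, True)] = f s"
      and w: "w \<in> carrier (free_group S)" for h w
  proof -
    interpret h: group_hom "free_group S" H h
      by (intro group_hom.intro group_hom_axioms.intro group_free_group H h)
    have letter: "h [x] = letter_val H f x" if "fst x \<in> S" for x
    proof (cases "snd x")
      case True
      then show ?thesis using gen that by (cases x) (auto simp: letter_val_def)
    next
      case False
      then have x: "[x] = inv\<^bsub>free_group S\<^esub> [(fst x, True)]"
        using that by (subst inv_free_group) (auto simp: free_group_simps inv_letter_def prod_eq_iff)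
      have "h [x] = inv (h [(fst x, True)])"
        unfolding x using that by (intro h.hom_inv) (auto simp: free_group_simps)
      then show ?thesis using False gen that by (simp add: letter_val_def)
    qed
    show ?thesis using w
    proof (induction w)
      case Nil
      then show ?case using h.hom_one by (simp add: free_group_simps)
    next
      case (Cons x w)
      then have w: "w \<in> carrier (free_group S)" and x: "[x] \<in> carrier (free_group S)"
        by (auto simp: free_group_simps dest: reduced_ConsD)
      have "x # w = [x] \<otimes>\<^bsub>free_group S\<^esub> w"
        using Cons.prems by (simp add: free_group_simps cons_letter_reduced)
      then have "h (x # w) = h [x] \<otimes> h w"
        using h.hom_mult[OF x w] by simp
      then show ?case
        using Cons.IH[OF w] letter x by (simp add: free_group_simps)
    qed
  qed
  show "h w = h' w"
    if "h \<in> hom (free_group S) H" "h' \<in> hom (free_group S) H"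
      "\<forall>s\<in>S. h [(s, True)] = f s" "\<forall>s\<in>S. h' [(s, True)] = f s"
      "w \<in> carrier (free_group S)"
    using val that by metis
qed

end

end

theory Submission
  imports Defs
begin

text \<open>
  Write \<open>a\<close>, \<open>b\<close> for the generators. For \<open>m \<ge> 1\<close> the set
  \<open>A = {1, a, \<dots>, a\<^sup>m} \<union> {b, b a}\<close> has \<open>|A A\<inverse>| = 4 m + 7\<close> and \<open>|A\<inverse> A| = 6 m + 5\<close>:
  the products of \<open>a\<^sup>i\<close> with \<open>(b a\<^sup>k)\<inverse>\<close> overlap, being determined by \<open>i - k\<close>, whereas the
  products of \<open>a\<^sup>-\<^sup>i\<close> with \<open>b a\<^sup>k\<close> are pairwise distinct. The difference \<open>2 - 2 m\<close> takes every
  nonpositive even value, and replacing \<open>A\<close> by \<open>A\<inverse>\<close> changes its sign.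
\<close>

section \<open>Inversion of quotient sets, and rewriting of set comprehensions\<close>

lemma (in group) right_quotient_set_inv_image:
  "A \<subseteq> carrier G \<Longrightarrow> right_quotient_set G (m_inv G ` A) = left_quotient_set G A"
  unfolding right_quotient_set_def left_quotient_set_def by (force simp: subset_iff)

lemma (in group) left_quotient_set_inv_image:
  "A \<subseteq> carrier G \<Longrightarrow> left_quotient_set G (m_inv G ` A) = right_quotient_set G A"
  unfolding right_quotient_set_def left_quotient_set_def by (force simp: subset_iff)

text \<open>In the form of unions, congruence applies and a union in the index set can be
  split.\<close>

lemma setcompr2_eq_UN: "{F u v | u v. u \<in> S \<and> v \<in> T} = (\<Union>u\<in>S. \<Union>v\<in>T. {F u v})"
  by blast

lemma image_Times_eq_setcompr2:
  "(\<lambda>(u, v). F u v) ` (S \<times> T) = {F u v | u v. u \<in> S \<and> v \<in> T}"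
  unfolding setcompr2_eq_UN by auto

lemma image_int_interval_diff:
  fixes p q :: int
  assumes "0 \<le> p" "0 \<le> q"
  shows "f ` {- q..p} = {f (i - j) | i j. i \<in> {0..p} \<and> j \<in> {0..q}}"
proof (intro equalityI subsetI)
  fix x assume "x \<in> f ` {- q..p}"
  then obtain k where k: "x = f k" "- q \<le> k" "k \<le> p" by auto
  \<comment> \<open>The positive and the negative part of \<open>k\<close>: one of them is 0, so
    both lie in their intervals.\<close>
  have "x = f (max k 0 - max (- k) 0)" "max k 0 \<in> {0..p}" "max (- k) 0 \<in> {0..q}"
    using k assms by (auto simp: max_def)
  then show "x \<in> {f (i - j) | i j. i \<in> {0..p} \<and> j \<in> {0..q}}" by blast
qed auto

section \<open>Integer powers of the generator a as reduced words\<close>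

text \<open>The power a^k for every integer \<open>k\<close>; integer exponents let products of
  powers become sums and differences of indices.\<close>

definition apow :: "int \<Rightarrow> nat word" where
  "apow k = replicate (nat \<bar>k\<bar>) (0, 0 \<le> k)"

abbreviation b :: "nat \<times> bool" where "b \<equiv> (1, True)"
abbreviation b' :: "nat \<times> bool" where "b' \<equiv> (1, False)"

lemma inv_letter_Pair [simp]: "inv_letter (x, s) = (x, \<not> s)"
  by (simp add: inv_letter_def)

lemma apow_0 [simp]: "apow 0 = []"
  by (simp add: apow_def)

lemma apow_pos: "0 < k \<Longrightarrow> apow k = (0, True) # apow (k - 1)"
  and apow_neg: "k < 0 \<Longrightarrow> apow k = (0, False) # apow (k + 1)"
proof -
  assume "0 < k"
  then have "nat \<bar>k\<bar> = Suc (nat \<bar>k - 1\<bar>)" by simp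
  then show "apow k = (0, True) # apow (k - 1)" using \<open>0 < k\<close> by (simp add: apow_def)
next
  assume "k < 0"
  then have "nat \<bar>k\<bar> = Suc (nat \<bar>k + 1\<bar>)" by simp
  \<comment> \<open>At \<open>k = -1\<close> the flag of \<open>apow (k + 1)\<close> turns to
    \<open>True\<close>, but that word is empty.\<close>
  then show "apow k = (0, False) # apow (k + 1)" using \<open>k < 0\<close>
    by (cases "k = -1") (simp_all add: apow_def)
qed

lemma apow_inject [simp]: "apow i = apow j \<longleftrightarrow> i = j"
  by (auto simp: apow_def replicate_eq_replicate)

lemma inverse_apow [simp]: "rev (map inv_letter (apow k)) = apow (- k)"
  by (cases "k = 0") (auto simp: apow_def)

lemma fst_apow: "x \<in> set (apow k) \<Longrightarrow> fst x = 0"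
  by (auto simp: apow_def split: if_splits)

lemma apow_append_inject [simp]:
  assumes "fst x \<noteq> 0" "fst y \<noteq> 0"
  shows "apow i @ x # u = apow j @ y # v \<longleftrightarrow> i = j \<and> x = y \<and> u = v"
proof
  assume eq: "apow i @ x # u = apow j @ y # v"
  \<comment> \<open>The maximal prefix of letters over the generator 0 recovers the
    exponent.\<close>
  have "takeWhile (\<lambda>z. fst z = 0) (apow k @ z # w) = apow k" if "fst z \<noteq> 0" for k z w
    using that by (subst takeWhile_append2) (auto dest: fst_apow)
  then have "i = j" using eq assms by (metis apow_inject)
  then show "i = j \<and> x = y \<and> u = v" using eq by simp
qed simp

lemma apow_neq_append [simp]:
  assumes "fst x \<noteq> 0"
  shows "apow i \<noteq> apow j @ x # u" "apow j @ x # u \<noteq> apow i"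
proof -
  show "apow i \<noteq> apow j @ x # u"
    using assms fst_apow[of x i] by auto
  then show "apow j @ x # u \<noteq> apow i" by metis
qed

text \<open>The case of exponent 0, where simplification has already removed the prefix
  \<open>apow 0\<close>.\<close>

lemma apow_eq_Cons [simp]:
  assumes "fst x \<noteq> 0"
  shows "apow i \<noteq> x # u" "x # u \<noteq> apow i"
    and "fst y \<noteq> 0 \<Longrightarrow> x # u = apow j @ y # v \<longleftrightarrow> j = 0 \<and> x = y \<and> u = v"
    and "fst y \<noteq> 0 \<Longrightarrow> apow j @ y # v = x # u \<longleftrightarrow> j = 0 \<and> x = y \<and> u = v"
  using apow_neq_append[OF assms, where i = i and j = 0 and u = u]
    apow_append_inject[OF assms, where y = y and i = 0 and u = u and j = j and v = v]
  by (auto simp del: apow_append_inject apow_neq_append)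

text \<open>Since \<open>v\<close> does not begin with a power of a, cancellation stops at the end
  of \<open>apow j\<close>. Induction in both directions from 0 adds one letter at a time.\<close>

lemma word_mult_apow:
  assumes "v = [] \<or> fst (hd v) \<noteq> 0"
  shows "word_mult (apow i) (apow j @ v) = apow (i + j) @ v"
proof -
  have cons_apow: "cons_letter (0, True) (apow k @ v) = apow (k + 1) @ v"
    "cons_letter (0, False) (apow k @ v) = apow (k - 1) @ v" for k
    using assms
    by (cases v; cases k "0::int" rule: linorder_cases; auto simp: apow_pos apow_neg)+
  show ?thesis
  proof (induction i rule: int_induct[where k = 0])
    case (step1 i)
    then show ?case using cons_apow(1)[of "i + j"] by (simp add: apow_pos algebra_simps)
  next
    case (step2 i)
    then show ?case using cons_apow(2)[of "i + j"] by (simp add: apow_neg algebra_simps)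
  qed simp
qed

lemmas word_mult_apow_simps [simp] =
  word_mult_apow[of "[]", simplified]
  word_mult_apow[of "x # v" for x v, simplified]
  word_mult_apow[of "x # v" _ 0 for x v, simplified]

text \<open>Only the first letter of the word can cancel with \<open>x\<close>, and a nonempty
  \<open>apow k\<close> shields what follows it. With \<open>x = b\<close>, a conjugate of a^k by b
  thus collapses only for \<open>k = 0\<close>.\<close>

lemma cons_letter_apow [simp]:
  assumes "fst x \<noteq> 0"
  shows "cons_letter x (apow k) = x # apow k"
    and "cons_letter x (apow k @ [inv_letter x]) = (if k = 0 then [] else x # apow k @ [inv_letter x])"
proof -
  obtain s where "apow k = [] \<or> (\<exists>u. apow k = (0, s) # u)"
    by (metis apow_neg apow_pos apow_0 linorder_cases)
  moreover have "apow k = [] \<longleftrightarrow> k = 0" by (simp add: apow_def)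
  ultimately show "cons_letter x (apow k) = x # apow k"
    "cons_letter x (apow k @ [inv_letter x]) = (if k = 0 then [] else x # apow k @ [inv_letter x])"
    using assms by (auto simp: inv_letter_def)
qed

lemma reduced_apow: "reduced (apow k)"
  by (auto simp: reduced_def apow_def successively_conv_nth)

lemma reduced_b_apow: "reduced (b # apow k)"
  using reduced_cons_letter[OF reduced_apow, of b k] by simp

section \<open>The witness set and its products\<close>

text \<open>Both halves are indexed by exponent intervals starting at 0, so
  \<open>image_int_interval_diff\<close> handles all differences.\<close>

definition witness :: "int \<Rightarrow> nat word set" where
  "witness m = apow ` {0..m} \<union> (\<lambda>k. b # apow k) ` {0..1}"

lemma witness_subset: "witness m \<subseteq> carrier F2"
proof
  fix w assume "w \<in> witness m"
  then obtain k where "w = apow k \<or> w = b # apow k" by (auto simp: witness_def)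
  then show "w \<in> carrier F2"
    using reduced_apow[of k] reduced_b_apow[of k] fst_apow[of _ k]
    by (elim disjE) (auto simp: F2_def free_group_simps)
qed

lemma finite_witness: "finite (witness m)"
  by (simp add: witness_def)

lemma F2_right_quotient:
  "\<lbrakk>u \<in> carrier F2; v \<in> carrier F2\<rbrakk> \<Longrightarrow>
    u \<otimes>\<^bsub>F2\<^esub> inv\<^bsub>F2\<^esub> v = word_mult u (rev (map inv_letter v))"
  by (simp add: F2_def free_group_simps(2) inv_free_group)

lemma F2_left_quotient:
  "\<lbrakk>u \<in> carrier F2; v \<in> carrier F2\<rbrakk> \<Longrightarrow>
    inv\<^bsub>F2\<^esub> u \<otimes>\<^bsub>F2\<^esub> v = word_mult (rev (map inv_letter u)) v"
  by (simp add: F2_def free_group_simps(2) inv_free_group)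

text \<open>An abstract \<open>F\<close> serves both quotient sets. Pairs from the same half come
  first, mixed pairs after them.\<close>

lemma mult_witness_set:
  "{F u v | u v. u \<in> witness m \<and> v \<in> witness m} =
    {F (apow i) (apow j) | i j. i \<in> {0..m} \<and> j \<in> {0..m}} \<union>
    {F (b # apow i) (b # apow j) | i j. i \<in> {0..1} \<and> j \<in> {0..1}} \<union>
    ({F (apow i) (b # apow j) | i j. i \<in> {0..m} \<and> j \<in> {0..1}} \<union>
    {F (b # apow i) (apow j) | i j. i \<in> {0..1} \<and> j \<in> {0..m}})"
  unfolding setcompr2_eq_UN witness_def by (simp add: UN_Un UN_Un_distrib Un_ac)

section \<open>Explicit form of the two quotient sets\<close>

text \<open>In all four blocks the powers of a meet in the middle, so each product depends only on a
  difference of exponents.\<close>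

lemma right_quotient_set_witness:
  assumes "1 \<le> m"
  shows "right_quotient_set F2 (witness m) =
    apow ` {- m..m} \<union> (\<lambda>k. b # apow k @ [b']) ` {- 1, 1} \<union>
    ((\<lambda>k. apow k @ [b']) ` {- 1..m} \<union> (\<lambda>k. b # apow k) ` {- m..1})"
proof -
  let ?f = "\<lambda>k. if k = 0 then [] else b # apow k @ [b']"
  have "right_quotient_set F2 (witness m) =
    {word_mult u (rev (map inv_letter v)) | u v. u \<in> witness m \<and> v \<in> witness m}"
    unfolding right_quotient_set_def setcompr2_eq_UN
    by (intro SUP_cong refl) (simp add: F2_right_quotient subsetD[OF witness_subset])
  also have "\<dots> =
    {apow (i - j) | i j. i \<in> {0..m} \<and> j \<in> {0..m}} \<union>
    {?f (i - j) | i j. i \<in> {0..1} \<and> j \<in> {0..1}} \<union>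
    ({apow (i - j) @ [b'] | i j. i \<in> {0..m} \<and> j \<in> {0..1}} \<union>
    {b # apow (i - j) | i j. i \<in> {0..1} \<and> j \<in> {0..m}})"
    unfolding mult_witness_set[where F = "\<lambda>u v. word_mult u (rev (map inv_letter v))"]
    using cons_letter_apow(2)[of b] by simp
  also have "\<dots> = apow ` {- m..m} \<union> ?f ` {- 1..1} \<union>
    ((\<lambda>k. apow k @ [b']) ` {- 1..m} \<union> (\<lambda>k. b # apow k) ` {- m..1})"
    using assms image_int_interval_diff[of 1 1 ?f]
    by (simp add: image_int_interval_diff)
  also have "?f ` {- 1..1} = insert (apow 0) ((\<lambda>k. b # apow k @ [b']) ` {- 1, 1})"
  proof -
    have "{- 1..1::int} = {-1, 0, 1}" by auto
    then show ?thesis by auto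
  qed
  \<comment> \<open>The identity, which the conjugates by b contribute at exponent 0, is already a
    power of a.\<close>
  also have "apow ` {- m..m} \<union> insert (apow 0) ((\<lambda>k. b # apow k @ [b']) ` {- 1, 1}) =
    apow ` {- m..m} \<union> (\<lambda>k. b # apow k @ [b']) ` {- 1, 1}"
  proof -
    have "apow 0 \<in> apow ` {- m..m}" using assms by (intro imageI) simp
    then show ?thesis by (simp only: Un_insert_right insert_absorb UnI1)
  qed
  finally show ?thesis .
qed

text \<open>Within a half only powers of a survive, since b cancels. In a mixed product the letter b
  or its inverse separates the two powers, so both exponents remain visible.\<close>

lemma left_quotient_set_witness:
  assumes "1 \<le> m"
  shows "left_quotient_set F2 (witness m) =
    apow ` {- m..m} \<union>
    ((\<lambda>(i, k). apow (- i) @ b # apow k) ` ({0..m} \<times> {0..1}) \<union>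
     (\<lambda>(k, i). apow (- k) @ b' # apow i) ` ({0..1} \<times> {0..m}))"
proof -
  have "left_quotient_set F2 (witness m) =
    {word_mult (rev (map inv_letter u)) v | u v. u \<in> witness m \<and> v \<in> witness m}"
    unfolding left_quotient_set_def setcompr2_eq_UN
    by (intro SUP_cong refl) (simp add: F2_left_quotient subsetD[OF witness_subset])
  also have "\<dots> =
    {apow (- (i - j)) | i j. i \<in> {0..m} \<and> j \<in> {0..m}} \<union>
    {apow (- (i - j)) | i j. i \<in> {0..1} \<and> j \<in> {0..1}} \<union>
    ({apow (- i) @ b # apow k | i k. i \<in> {0..m} \<and> k \<in> {0..1}} \<union>
    {apow (- k) @ b' # apow i | k i. k \<in> {0..1} \<and> i \<in> {0..m}})"
    unfolding mult_witness_set[where F = "\<lambda>u v. word_mult (rev (map inv_letter u)) v"]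
    by (simp add: word_mult_append)
  also have "\<dots> = (\<lambda>k. apow (- k)) ` {- m..m} \<union> (\<lambda>k. apow (- k)) ` {- 1..1} \<union>
    ((\<lambda>(i, k). apow (- i) @ b # apow k) ` ({0..m} \<times> {0..1}) \<union>
     (\<lambda>(k, i). apow (- k) @ b' # apow i) ` ({0..1} \<times> {0..m}))"
    using assms
    by (simp only: image_int_interval_diff[where f = "\<lambda>k. apow (- k)"] image_Times_eq_setcompr2)
  also have "\<dots> = apow ` {- m..m} \<union> apow ` {- 1..1} \<union>
    ((\<lambda>(i, k). apow (- i) @ b # apow k) ` ({0..m} \<times> {0..1}) \<union>
     (\<lambda>(k, i). apow (- k) @ b' # apow i) ` ({0..1} \<times> {0..m}))"
    using image_image[of apow uminus "{- p..p}" for p] by simp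
  \<comment> \<open>Here \<open>1 \<le> m\<close> enters: the quotients of b and ba are among the
    powers from the other half.\<close>
  also have "apow ` {- m..m} \<union> apow ` {- 1..1} = apow ` {- m..m}"
    using assms by (intro Un_absorb2 image_mono) auto
  finally show ?thesis .
qed

section \<open>Cardinalities\<close>

text \<open>The four families are disjoint because they differ in which of \<open>b\<close> and
  \<open>b'\<close> occur: neither, both, only \<open>b'\<close>, only \<open>b\<close>.\<close>

lemma card_right_quotient_set_witness:
  assumes "1 \<le> m"
  shows "int (card (right_quotient_set F2 (witness m))) = 4 * m + 7"
proof -
  let ?A = "apow ` {- m..m}"
  let ?B = "(\<lambda>k. b # apow k @ [b']) ` {- 1, 1}"
  let ?C = "(\<lambda>k. apow k @ [b']) ` {- 1..m}"
  let ?D = "(\<lambda>k. b # apow k) ` {- m..1}"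
  have "int (card ?A) = 2 * m + 1" "int (card ?B) = 2" "int (card ?C) = m + 2" "int (card ?D) = m + 2"
    using assms by (simp_all add: card_image inj_on_def split_def prod_eq_iff)
  moreover have "?A \<inter> ?B = {}" "?C \<inter> ?D = {}" "(?A \<union> ?B) \<inter> (?C \<union> ?D) = {}"
    by auto
  ultimately show ?thesis
    unfolding right_quotient_set_witness[OF assms] by (simp add: card_Un_disjoint)
qed

text \<open>Both exponents around the single \<open>b\<close> or \<open>b'\<close> can be read off
  the word, so the mixed families are as large as their index sets.\<close>

lemma card_left_quotient_set_witness:
  assumes "1 \<le> m"
  shows "int (card (left_quotient_set F2 (witness m))) = 6 * m + 5"
proof -
  let ?A = "apow ` {- m..m}"
  let ?B = "(\<lambda>(i, k). apow (- i) @ b # apow k) ` ({0..m} \<times> {0..1})"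
  let ?C = "(\<lambda>(k, i). apow (- k) @ b' # apow i) ` ({0..1} \<times> {0..m})"
  have "int (card ?A) = 2 * m + 1" "int (card ?B) = 2 * (m + 1)" "int (card ?C) = 2 * (m + 1)"
    using assms by (simp_all add: card_image inj_on_def split_def prod_eq_iff)
  moreover have "?B \<inter> ?C = {}" "?A \<inter> (?B \<union> ?C) = {}"
    by auto
  ultimately show ?thesis
    unfolding left_quotient_set_witness[OF assms] by (simp add: card_Un_disjoint)
qed

theorem theorem1p5:
  fixes n :: int
  shows "\<exists>A. A \<subseteq> carrier F2 \<and> finite A \<and>
    int (card (right_quotient_set F2 A)) - int (card (left_quotient_set F2 A)) = 2 * n"
proof -
  interpret group F2 unfolding F2_def by (rule group_free_group)
  \<comment> \<open>The summand 1 keeps the parameter at least 1 and makes 2 - 2 m equal to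
    \<open>- 2 * \<bar>n\<bar>\<close>.\<close>
  define A where "A = witness (1 + \<bar>n\<bar>)"
  have A: "A \<subseteq> carrier F2" "finite A"
    "int (card (right_quotient_set F2 A)) - int (card (left_quotient_set F2 A)) = - 2 * \<bar>n\<bar>"
    by (simp_all add: A_def witness_subset finite_witness
        card_right_quotient_set_witness card_left_quotient_set_witness)
  show ?thesis
  proof (cases "n \<le> 0")
    case True
    then show ?thesis using A by (intro exI[of _ A]) simp
  next
    case False
    then show ?thesis using A
      by (intro exI[of _ "m_inv F2 ` A"])
        (auto simp: right_quotient_set_inv_image left_quotient_set_inv_image)
  qed
qed

end
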